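(* Let $n=3$. For any constant $C\in\mathbb{R}$, the following are biharmonic Green functions for $\mathbb{R}^4_+$ with respect to the boundary operator pairs $(\mathscr{B}^3_i,\mathscr{B}^3_j)$, for $X,Y\in\overline{\mathbb{R}^4_+}$, $X\ne Y$: $$G^{(0,1)}(X,Y)=\Gamma(X-Y)-\Gamma(\bar X-Y)+\frac{1}{8|\mathbb{S}^3|}\Big(\frac{|X-Y|^2}{|\bar X-Y|^2}-1\Big),$$ $$G^{(2,3)}(X,Y)=\Gamma(X-Y)+\Gamma(\bar X-Y)-\frac{1}{8|\mathbb{S}^3|}\Big(\frac{|X-Y|^2}{|\bar X-Y|^2}-1\Big)+C,$$ $$G^{(0,2)}(X,Y)=\Gamma(X-Y)-\Gamma(\bar X-Y),\qquad G^{(1,3)}(X,Y)=\Gamma(X-Y)+\Gamma(\bar X-Y)+C,$$ where $\bar X=(x,-t)$ for $X=(x,t)$.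
   Context: $\mathbb{R}^4_+=\{X=(x,t):x\in\mathbb{R}^3,\ t>0\}$; $\Delta$, $\overline\Delta$ are the Laplacians on $\mathbb{R}^4$ and $\mathbb{R}^3$. The fundamental solution of $\Delta^2$ in $\mathbb{R}^4$ is $\Gamma(X-Y)=-\frac{1}{4|\mathbb{S}^3|}\log|X-Y|$. The conformal boundary operators are $\mathscr{B}^3_0(u)=u$, $\mathscr{B}^3_1(u)=-\partial_tu$, $\mathscr{B}^3_2(u)=\partial_t^2u-\overline\Delta u$, $\mathscr{B}^3_3(u)=\partial_t\Delta u+2\overline\Delta\partial_tu$. A biharmonic Green function for $(\mathscr{B}^3_i,\mathscr{B}^3_j)$ ($i<j$, $i+j\neq3$) is a function $G^{(i,j)}(X,Y)=\Gamma(X-Y)+H^{(i,j)}(X,Y)$ such that, for each fixed $X\in\mathbb{R}^4_+$, the function $Y\mapsto H^{(i,j)}(X,Y)$ solves $\Delta^2H^{(i,j)}=0$ in $\mathbb{R}^4_+$, $\mathscr{B}^3_i(H^{(i,j)})=-\mathscr{B}^3_i(\Gamma)$ and $\mathscr{B}^3_j(H^{(i,j)})=-\mathscr{B}^3_j(\Gamma)$ on $\partial\mathbb{R}^4_+$, where the operators act in the variable $Y$ on $\Gamma(X-Y)$ (with the last coordinate of $Y$ in the role of $t$). *)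

theory Defs
  imports "HOL-Analysis.Analysis"
begin

type_synonym pt = "(real^3) \<times> real"

definition half_space :: "pt set" where
  "half_space = {Y. 0 < snd Y}"

definition closed_half_space :: "pt set" where
  "closed_half_space = {Y. 0 \<le> snd Y}"

definition half_space_boundary :: "pt set" where
  "half_space_boundary = {Y. snd Y = 0}"

lemma half_space_topology:
  shows "closure half_space = closed_half_space"
    and "frontier half_space = half_space_boundary"
proof -
  have n: "(0, 1) \<noteq> (0 :: pt)"
    by (simp add: prod_eq_iff)
  have eq: "half_space = {Y. inner (0, 1) Y > 0}"
    by (auto simp: half_space_def inner_prod_def)
  show "closure half_space = closed_half_space"
    unfolding eq closure_halfspace_gt[OF n]
    by (auto simp: closed_half_space_def inner_prod_def)
  show "frontier half_space = half_space_boundary"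
    unfolding eq frontier_halfspace_gt[OF disjI1[OF n]]
    by (auto simp: half_space_boundary_def inner_prod_def)
qed

definition reflect :: "pt \<Rightarrow> pt" where
  "reflect X = (fst X, - snd X)"

text \<open>
  The functions considered live on the closed half-space. The set of admissible increments \<open>h\<close>
  makes the derivative below the usual directional derivative at interior points, and the
  one-sided derivative in the normal direction at boundary points.
\<close>

definition increments :: "pt \<Rightarrow> pt \<Rightarrow> real set" where
  "increments b Y = {h. Y + h *\<^sub>R b \<in> closed_half_space}"

definition partial :: "pt \<Rightarrow> (pt \<Rightarrow> real) \<Rightarrow> pt \<Rightarrow> real" where
  "partial b u Y = vector_derivative (\<lambda>h. u (Y + h *\<^sub>R b)) (at 0 within increments b Y)"

lemma partial_interior:
  assumes "Y \<in> half_space"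
  shows "partial b u Y = vector_derivative (\<lambda>h. u (Y + h *\<^sub>R b)) (at 0)"
proof -
  have "open {h. 0 < snd Y + h * snd b}"
    by (intro open_Collect_less continuous_intros)
  moreover have "0 \<in> {h. 0 < snd Y + h * snd b}"
    using assms by (simp add: half_space_def)
  moreover have "{h. 0 < snd Y + h * snd b} \<subseteq> increments b Y"
    by (auto simp: increments_def closed_half_space_def)
  ultimately have "0 \<in> interior (increments b Y)"
    by (rule interiorI)
  then show ?thesis
    unfolding partial_def by (simp only: at_within_interior)
qed

text \<open>
  \<open>C_upto k u\<close>: all iterated partial derivatives of \<open>u\<close> of order at most \<open>k\<close> exist and are
  continuous on the closed half-space.
\<close>

fun C_upto :: "nat \<Rightarrow> (pt \<Rightarrow> real) \<Rightarrow> bool" where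
  "C_upto 0 u \<longleftrightarrow> continuous_on closed_half_space u"
| "C_upto (Suc k) u \<longleftrightarrow> continuous_on closed_half_space u \<and>
     (\<forall>b\<in>Basis.
        (\<forall>Y\<in>closed_half_space.
           (\<lambda>h. u (Y + h *\<^sub>R b)) differentiable (at 0 within increments b Y)) \<and>
        C_upto k (partial b u))"

definition laplacian :: "(pt \<Rightarrow> real) \<Rightarrow> pt \<Rightarrow> real" where
  "laplacian u Y = (\<Sum>b\<in>Basis. partial b (partial b u) Y)"

definition tangential_laplacian :: "(pt \<Rightarrow> real) \<Rightarrow> pt \<Rightarrow> real" where
  "tangential_laplacian u Y = (\<Sum>e\<in>Basis. partial (e, 0) (partial (e, 0) u) Y)"

definition dt :: "(pt \<Rightarrow> real) \<Rightarrow> pt \<Rightarrow> real" where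
  "dt u = partial (0, 1) u"

text \<open>The value for indices above 3 is irrelevant.\<close>

definition boundary_op :: "nat \<Rightarrow> (pt \<Rightarrow> real) \<Rightarrow> pt \<Rightarrow> real" where
  "boundary_op i u Y =
     (if i = 0 then u Y
      else if i = 1 then - dt u Y
      else if i = 2 then dt (dt u) Y - tangential_laplacian u Y
      else if i = 3 then dt (laplacian u) Y + 2 * tangential_laplacian (dt u) Y
      else 0)"

text \<open>
  The surface area of the unit sphere of \<open>pt\<close>, by the cone formula
  (dimension times the volume of the unit ball).
\<close>

definition sphere3_area :: real where
  "sphere3_area = real DIM(pt) * measure lborel (ball (0::pt) 1)"

lemma sphere3_area_eq: "sphere3_area = 2 * pi\<^sup>2"
proof -
  have "unit_ball_vol (real (2 * 2)) = pi ^ 2 / fact 2"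
    by (rule unit_ball_vol_even)
  then have *: "unit_ball_vol 4 = pi\<^sup>2 / 2"
    by simp
  have dim: "DIM(pt) = 4"
    by simp
  have "measure lborel (ball (0::pt) 1) = unit_ball_vol (real DIM(pt)) * 1 ^ DIM(pt)"
    by (rule content_ball) simp
  then show ?thesis
    by (simp only: sphere3_area_def dim) (simp add: *)
qed

definition fund_sol :: "pt \<Rightarrow> real" where
  "fund_sol Z = - (1 / (4 * sphere3_area)) * ln (norm Z)"

text \<open>
  The regular part \<open>H\<close> is pinned down by \<open>G\<close> off the diagonal and by its continuity.
  The conditions are required for poles \<open>X\<close> in the open half-space only.
\<close>

definition biharmonic_green :: "nat \<Rightarrow> nat \<Rightarrow> (pt \<Rightarrow> pt \<Rightarrow> real) \<Rightarrow> bool" where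
  "biharmonic_green i j G \<longleftrightarrow>
     i < j \<and> j \<le> 3 \<and> i + j \<noteq> 3 \<and>
     (\<exists>H :: pt \<Rightarrow> pt \<Rightarrow> real.
        (\<forall>X\<in>closed_half_space. \<forall>Y\<in>closed_half_space.
           X \<noteq> Y \<longrightarrow> G X Y = fund_sol (X - Y) + H X Y) \<and>
        (\<forall>X\<in>half_space.
           C_upto 4 (H X) \<and>
           (\<forall>Y\<in>half_space. laplacian (laplacian (H X)) Y = 0) \<and>
           (\<forall>k\<in>{i, j}. \<forall>Y\<in>half_space_boundary.
              boundary_op k (H X) Y = - boundary_op k (\<lambda>Y. fund_sol (X - Y)) Y)))"

end

theory Submission
  imports Defs
begin

text \<open>
  Put \<open>\<rho>(Y) = |Y - P|\<^sup>2\<close>, \<open>s\<close> the last coordinate of \<open>Y\<close>, and \<open>t\<close> that of \<open>X\<close>. Since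
  \<open>|X - Y|\<^sup>2 = |reflect X - Y|\<^sup>2 - 4ts\<close>, all four regular parts, as well as \<open>\<Gamma>(X - Y)\<close> itself,
  have the form \<open>a ln \<rho> + b s/\<rho> + g\<close>, with pole \<open>P = reflect X\<close> or \<open>P = X\<close> and \<open>b\<close> proportional
  to \<open>t\<close>. Their Laplacian \<open>4a/\<rho> - 4b \<tau>/\<rho>\<^sup>2\<close>, with \<open>\<tau>\<close> the last coordinate of \<open>Y - P\<close>, is harmonic,
  and on the boundary the operators take the values \<open>a ln \<rho> + g\<close>, \<open>-(2a\<tau> + b)/\<rho>\<close>,
  \<open>-(8a\<tau>\<^sup>2 + 4b\<tau>)/\<rho>\<^sup>2\<close> and \<open>-32a\<tau>\<^sup>3/\<rho>\<^sup>3\<close>. Passing from \<open>reflect X\<close> to \<open>X\<close> preserves \<open>\<rho>\<close> on the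
  boundary and changes the sign of \<open>\<tau>\<close>.
\<close>

section \<open>Differentiability on the closed half-space\<close>

text \<open>From a point of a half-space at least one of the directions \<open>b\<close> and
  \<open>-b\<close> never leaves it. Hence derivatives within \<open>increments b Y\<close> are
  unique, also at boundary points.\<close>

lemma increments_nontrivial:
  assumes "Y \<in> closed_half_space"
  shows "at 0 within increments b Y \<noteq> bot"
proof -
  \<comment> \<open>The sign for which \<open>\<sigma> * snd b\<close> is nonnegative.\<close>
  define \<sigma> :: real where "\<sigma> = (if snd b \<ge> 0 then 1 else -1)"
  have mem: "\<sigma> * r \<in> increments b Y" if "r > 0" for r
  proof -
    have "0 \<le> (\<sigma> * r) * snd b"
      using that by (auto simp: \<sigma>_def mult_nonneg_nonpos)
    then show ?thesis
      using assms by (auto simp: increments_def closed_half_space_def)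
  qed
  have "0 islimpt increments b Y"
    unfolding islimpt_approachable
  proof (intro allI impI)
    fix e :: real assume "e > 0"
    then show "\<exists>x'\<in>increments b Y. x' \<noteq> 0 \<and> dist x' 0 < e"
      using mem[of "e/2"] by (intro bexI[of _ "\<sigma> * (e/2)"]) (auto simp: \<sigma>_def)
  qed
  then show ?thesis
    by (simp add: trivial_limit_within)
qed

lemma partial_unique:
  assumes "Y \<in> closed_half_space"
    and "((\<lambda>h. u (Y + h *\<^sub>R b)) has_real_derivative D) (at 0 within increments b Y)"
  shows "partial b u Y = D"
  using assms increments_nontrivial[OF assms(1)]
  by (simp add: partial_def vector_derivative_within has_real_derivative_iff_has_vector_derivative)

lemma partial_works:
  assumes "(\<lambda>h. u (Y + h *\<^sub>R b)) differentiable (at 0 within increments b Y)"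
  shows "((\<lambda>h. u (Y + h *\<^sub>R b)) has_real_derivative partial b u Y) (at 0 within increments b Y)"
  using assms
  by (simp add: partial_def vector_derivative_works has_real_derivative_iff_has_vector_derivative)

text \<open>Reduces \<open>partial\<close> to ordinary two-sided calculus: a formula
  \<open>f\<close> that agrees with \<open>u\<close> only near \<open>Y\<close> and only inside the
  closed half-space may be differentiated along the full line. This also covers one-sided
  derivatives at the boundary.\<close>

lemma partial_eqI:
  assumes "open S" "Y \<in> S" "Y \<in> closed_half_space"
    and eq: "\<And>Z. Z \<in> S \<Longrightarrow> Z \<in> closed_half_space \<Longrightarrow> u Z = f Z"
    and f: "((\<lambda>h. f (Y + h *\<^sub>R b)) has_real_derivative D) (at 0)"
  shows "partial b u Y = D"
proof (rule partial_unique[OF assms(3)])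
  have "((\<lambda>h::real. Y + h *\<^sub>R b) \<longlongrightarrow> Y + 0 *\<^sub>R b) (at 0 within increments b Y)"
    by (intro tendsto_intros)
  then have "\<forall>\<^sub>F h in at 0 within increments b Y. Y + h *\<^sub>R b \<in> S"
    using assms(1,2) by (auto dest: topological_tendstoD)
  moreover have "\<forall>\<^sub>F h in at 0 within increments b Y. h \<in> increments b Y"
    by (auto simp: eventually_at_filter)
  ultimately have "\<forall>\<^sub>F h in at 0 within increments b Y. f (Y + h *\<^sub>R b) = u (Y + h *\<^sub>R b)"
    by eventually_elim (auto simp: increments_def eq)
  \<comment> \<open>The filter omits \<open>h = 0\<close>, but the difference quotient uses the
    value there.\<close>
  moreover have "f (Y + 0 *\<^sub>R b) = u (Y + 0 *\<^sub>R b)"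
    using assms(2,3) eq by simp
  ultimately show "((\<lambda>h. u (Y + h *\<^sub>R b)) has_real_derivative D) (at 0 within increments b Y)"
    using has_field_derivative_at_within[OF f, of "increments b Y"]
    by (rule has_field_derivative_cong_eventually[THEN iffD1])
qed

text \<open>Admissible increments stay in the closed half-space, so \<open>partial\<close> never
  sees values outside it, and neither do its iterates.\<close>

lemma C_upto_cong:
  assumes "C_upto k u" "\<And>Y. Y \<in> closed_half_space \<Longrightarrow> u Y = v Y"
  shows "C_upto k v"
  using assms
proof (induction k arbitrary: u v)
  case 0
  then show ?case
    using continuous_on_cong[of closed_half_space closed_half_space u v] by simp
next
  case (Suc k)
  have der: "((\<lambda>h. v (Y + h *\<^sub>R b)) has_real_derivative partial b u Y) (at 0 within increments b Y)"
    if "b \<in> Basis" "Y \<in> closed_half_space" for b Y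
  proof (rule has_field_derivative_transform_within[OF partial_works zero_less_one])
    show "(\<lambda>h. u (Y + h *\<^sub>R b)) differentiable (at 0 within increments b Y)"
      using Suc.prems(1) that by auto
  qed (use that Suc.prems(2) in \<open>auto simp: increments_def\<close>)
  have "C_upto k (partial b v)" if "b \<in> Basis" for b
    by (rule Suc.IH[of "partial b u"])
      (use Suc.prems(1) that in \<open>auto simp: partial_unique[OF _ der]\<close>)
  moreover have "continuous_on closed_half_space v"
    using Suc.prems continuous_on_cong[of closed_half_space closed_half_space u v] by simp
  ultimately show ?case
    using der unfolding C_upto.simps real_differentiable_def by blast
qed

text \<open>The candidates \<open>D b\<close> agree with \<open>partial b u\<close> on the closed
  half-space only; \<open>C_upto_cong\<close> transfers their regularity.\<close>

lemma C_upto_SucI: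
  assumes "continuous_on closed_half_space u"
    and der: "\<And>b Y. b \<in> Basis \<Longrightarrow> Y \<in> closed_half_space \<Longrightarrow>
      ((\<lambda>h. u (Y + h *\<^sub>R b)) has_real_derivative D b Y) (at 0 within increments b Y)"
    and "\<And>b. b \<in> Basis \<Longrightarrow> C_upto k (D b)"
  shows "C_upto (Suc k) u"
proof -
  have "C_upto k (partial b u)" if "b \<in> Basis" for b
    by (rule C_upto_cong[OF assms(3)[OF that]]) (simp add: partial_unique[OF _ der] that)
  then show ?thesis
    using assms(1) der unfolding C_upto.simps real_differentiable_def by blast
qed

lemma C_upto_continuous: "C_upto k u \<Longrightarrow> continuous_on closed_half_space u"
  by (cases k) auto

lemma C_upto_partial:
  assumes "C_upto (Suc k) u" "b \<in> Basis"
  shows "C_upto k (partial b u)"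
    and "Y \<in> closed_half_space \<Longrightarrow>
      ((\<lambda>h. u (Y + h *\<^sub>R b)) has_real_derivative partial b u Y) (at 0 within increments b Y)"
  using assms by (auto intro: partial_works)

lemma C_upto_Suc_imp: "C_upto (Suc k) u \<Longrightarrow> C_upto k u"
  by (induction k arbitrary: u) auto

section \<open>Closure properties of \<open>C_upto\<close>\<close>

lemma C_upto_const: "C_upto k (\<lambda>_. c)"
proof (induction k arbitrary: c)
  case (Suc k)
  show ?case
    by (rule C_upto_SucI[where D = "\<lambda>_ _. 0"]) (auto intro: Suc)
qed auto

lemma C_upto_inner: "C_upto k (\<lambda>Y. a \<bullet> Y)"
proof (cases k)
  case (Suc m)
  show ?thesis
    unfolding Suc
  proof (rule C_upto_SucI[where D = "\<lambda>b _. a \<bullet> b"])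
    show "((\<lambda>h. a \<bullet> (Y + h *\<^sub>R b)) has_real_derivative a \<bullet> b) (at 0 within increments b Y)" for b Y
      by (auto intro!: derivative_eq_intros simp: inner_add_right)
  qed (intro continuous_intros C_upto_const)+
qed (auto intro!: continuous_intros)

lemma C_upto_add:
  assumes "C_upto k u" "C_upto k v"
  shows "C_upto k (\<lambda>Y. u Y + v Y)"
  using assms
proof (induction k arbitrary: u v)
  case (Suc k)
  note d = C_upto_partial[OF Suc.prems(1)] C_upto_partial[OF Suc.prems(2)]
  show ?case
    by (rule C_upto_SucI[where D = "\<lambda>b Y. partial b u Y + partial b v Y"])
      (intro continuous_on_add Suc.prems[THEN C_upto_continuous] Suc.IH DERIV_add d; assumption)+
qed (auto intro: continuous_intros)

lemma C_upto_mult: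
  assumes "C_upto k u" "C_upto k v"
  shows "C_upto k (\<lambda>Y. u Y * v Y)"
  using assms
proof (induction k arbitrary: u v)
  case (Suc k)
  note d = C_upto_partial[OF Suc.prems(1)] C_upto_partial[OF Suc.prems(2)]
  show ?case
  proof (rule C_upto_SucI[where D = "\<lambda>b Y. partial b u Y * v Y + partial b v Y * u Y"])
    show "C_upto k (\<lambda>Y. partial b u Y * v Y + partial b v Y * u Y)" if "b \<in> Basis" for b
      by (intro C_upto_add Suc.IH d(1,3)[OF that] Suc.prems[THEN C_upto_Suc_imp])
    show "((\<lambda>h. u (Y + h *\<^sub>R b) * v (Y + h *\<^sub>R b)) has_real_derivative
        partial b u Y * v Y + partial b v Y * u Y) (at 0 within increments b Y)"
      if "b \<in> Basis" "Y \<in> closed_half_space" for b Y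
      using DERIV_mult[OF d(2) d(4), OF that that] by (simp add: algebra_simps)
  qed (intro continuous_on_mult Suc.prems[THEN C_upto_continuous])
qed (auto intro: continuous_intros)

lemma C_upto_inverse:
  assumes "C_upto k u" "\<And>Y. Y \<in> closed_half_space \<Longrightarrow> u Y \<noteq> 0"
  shows "C_upto k (\<lambda>Y. inverse (u Y))"
  using assms
proof (induction k arbitrary: u)
  case (Suc k)
  note d = C_upto_partial[OF Suc.prems(1)]
  show ?case
  \<comment> \<open>The derivative is a product in which \<open>inverse (u Y)\<close> recurs, so the
    induction hypothesis and \<open>C_upto_mult\<close> suffice.\<close>
  proof (rule C_upto_SucI[where D = "\<lambda>b Y. (-1) * ((inverse (u Y) * partial b u Y) * inverse (u Y))"])
    show "C_upto k (\<lambda>Y. (-1) * ((inverse (u Y) * partial b u Y) * inverse (u Y)))" if "b \<in> Basis" for b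
      by (intro C_upto_mult C_upto_const Suc.IH d(1)[OF that] Suc.prems(1)[THEN C_upto_Suc_imp]
        Suc.prems(2))
    show "((\<lambda>h. inverse (u (Y + h *\<^sub>R b))) has_real_derivative
        (-1) * ((inverse (u Y) * partial b u Y) * inverse (u Y))) (at 0 within increments b Y)"
      if "b \<in> Basis" "Y \<in> closed_half_space" for b Y
      using DERIV_inverse'[OF d(2)[OF that]] Suc.prems(2)[OF that(2)] by simp
  qed (intro continuous_on_inverse Suc.prems(1)[THEN C_upto_continuous] ballI Suc.prems(2))
qed (simp add: continuous_on_inverse)

text \<open>One differentiation turns the logarithm into a product with a reciprocal, so a case
  split replaces induction.\<close>

lemma C_upto_ln:
  assumes "C_upto k u" and pos: "\<And>Y. Y \<in> closed_half_space \<Longrightarrow> u Y > 0"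
  shows "C_upto k (\<lambda>Y. ln (u Y))"
proof (cases k)
  case 0
  then show ?thesis
    using assms(1) by (auto intro!: continuous_on_ln dest!: pos)
next
  case (Suc m)
  note u = assms(1)[unfolded Suc]
  show ?thesis
    unfolding Suc
  proof (rule C_upto_SucI[where D = "\<lambda>b Y. inverse (u Y) * partial b u Y"])
    show "continuous_on closed_half_space (\<lambda>Y. ln (u Y))"
      using C_upto_continuous[OF u] by (rule continuous_on_ln) (auto dest!: pos)
    show "C_upto m (\<lambda>Y. inverse (u Y) * partial b u Y)" if "b \<in> Basis" for b
      using pos C_upto_partial[OF u that]
      by (intro C_upto_mult C_upto_inverse C_upto_Suc_imp[OF u]) fastforce+
    show "((\<lambda>h. ln (u (Y + h *\<^sub>R b))) has_real_derivative inverse (u Y) * partial b u Y)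
        (at 0 within increments b Y)" if "b \<in> Basis" "Y \<in> closed_half_space" for b Y
      using C_upto_partial(2)[OF u that] pos[OF that(2)]
      by (auto intro!: derivative_eq_intros simp: divide_inverse)
  qed
qed

section \<open>Functions with a logarithmic pole\<close>

definition sqd :: "pt \<Rightarrow> pt \<Rightarrow> real" where
  "sqd P Y = (Y - P) \<bullet> (Y - P)"

text \<open>On the boundary the operators depend on \<open>Y\<close> only through
  \<open>\<tau> = snd (Y - P)\<close> and \<open>q = sqd P Y\<close>, so matching the poles
  \<open>X\<close> and \<open>reflect X\<close> becomes scalar algebra.\<close>

definition boundary_value :: "nat \<Rightarrow> real \<Rightarrow> real \<Rightarrow> real \<Rightarrow> real \<Rightarrow> real \<Rightarrow> real" where
  "boundary_value k a b g \<tau> q =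
     (if k = 0 then a * ln q + g
      else if k = 1 then - (2 * a * \<tau> + b) / q
      else if k = 2 then - (8 * a * \<tau>\<^sup>2 + 4 * b * \<tau>) / q\<^sup>2
      else - 32 * a * \<tau> ^ 3 / q ^ 3)"

definition log_pole :: "pt \<Rightarrow> real \<Rightarrow> real \<Rightarrow> real \<Rightarrow> pt \<Rightarrow> real" where
  "log_pole P a b g Y = a * ln (sqd P Y) + b * snd Y / sqd P Y + g"

lemma sqd_pos: "Y \<noteq> P \<Longrightarrow> sqd P Y > 0"
  by (simp add: sqd_def)

lemma sqd_eq_norm: "sqd P Y = (norm (P - Y))\<^sup>2"
  by (simp add: sqd_def dot_square_norm norm_minus_commute)

lemma C_upto_sqd: "C_upto k (sqd P)"
proof -
  have sqd: "sqd P = (\<lambda>Y. \<Sum>b\<in>Basis. (b \<bullet> Y + - (b \<bullet> P)) * (b \<bullet> Y + - (b \<bullet> P)))"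
    by (subst fun_eq_iff, subst sqd_def, subst euclidean_inner)
      (simp add: inner_diff_right inner_commute inner_diff_left)
  \<comment> \<open>Generalised from \<open>Basis\<close> to a finite \<open>B\<close> to allow
    induction on the set.\<close>
  have "C_upto k (\<lambda>Y. \<Sum>b\<in>B. (b \<bullet> Y + c b) * (b \<bullet> Y + c b))"
    if "finite B" for B and c :: "pt \<Rightarrow> real"
    using that by induction (auto intro!: C_upto_add C_upto_mult C_upto_inner C_upto_const)
  from this[OF finite_Basis, of "\<lambda>b. - (b \<bullet> P)"] show ?thesis
    unfolding sqd .
qed

lemma C_upto_log_pole:
  assumes "P \<notin> closed_half_space"
  shows "C_upto k (log_pole P a b g)"
proof -
  have pos: "sqd P Y > 0" if "Y \<in> closed_half_space" for Y
    using assms that by (intro sqd_pos) auto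
  have "C_upto k (\<lambda>Y. a * ln (sqd P Y) + b * (((0, 1) \<bullet> Y) * inverse (sqd P Y)) + g)"
    by (intro C_upto_add C_upto_mult C_upto_const C_upto_inner C_upto_ln C_upto_inverse C_upto_sqd)
      (use pos in fastforce)+
  then show ?thesis
    by (rule C_upto_cong) (simp add: log_pole_def inner_prod_def divide_inverse)
qed

text \<open>Along a line the squared distance is a quadratic polynomial in \<open>h\<close>.\<close>

lemma DERIV_sqd [derivative_intros]:
  "((\<lambda>h. sqd P (Y + h *\<^sub>R b)) has_real_derivative 2 * (b \<bullet> (Y - P))) (at 0)"
proof -
  have "(\<lambda>h. sqd P (Y + h *\<^sub>R b)) = (\<lambda>h. sqd P Y + h * (2 * (b \<bullet> (Y - P))) + h\<^sup>2 * (b \<bullet> b))"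
    by (auto simp: sqd_def inner_simps inner_commute power2_eq_square algebra_simps)
  then show ?thesis
    by (auto intro!: derivative_eq_intros)
qed

lemma DERIV_inner_line [derivative_intros]:
  "((\<lambda>h. b \<bullet> (Y + h *\<^sub>R b - P)) has_real_derivative b \<bullet> b) (at 0)"
  for b Y P :: "'a::real_inner"
  by (auto intro!: derivative_eq_intros simp: inner_simps)

lemma sum_Basis_inner_square: "(\<Sum>b\<in>Basis. (b \<bullet> Z)\<^sup>2) = Z \<bullet> Z"
  for Z :: "'a::euclidean_space"
  by (subst euclidean_inner) (simp add: power2_eq_square inner_commute)

text \<open>Evaluates the mixed terms of the Laplacian of a product, where one factor is linear in
  the last coordinate and the other is a power of \<open>sqd P Y\<close>.\<close>

lemma sum_Basis_snd_inner: "(\<Sum>b\<in>Basis. snd b * (b \<bullet> Z)) = snd Z" for Z :: pt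
  using euclidean_inner[of "(0, 1)" Z] by (simp add: inner_prod_def inner_commute mult.commute)

section \<open>Directional derivatives and Laplacians of \<open>log_pole\<close>\<close>

context
  fixes P :: pt
begin

text \<open>The complement of \<open>P\<close> is open, so a formula valid off the pole can be
  differentiated again. The pole may lie in the closed half-space, as it does for
  \<open>\<Gamma>(X - Y)\<close>.\<close>

lemma partial_offpole:
  assumes "Y \<in> closed_half_space - {P}"
    and "\<And>Z. Z \<in> closed_half_space - {P} \<Longrightarrow> u Z = f Z"
    and "((\<lambda>h. f (Y + h *\<^sub>R b)) has_real_derivative D) (at 0)"
  shows "partial b u Y = D"
  by (rule partial_eqI[of "- {P}" Y u f]) (use assms in auto)

text \<open>An arbitrary \<open>v\<close> covers the basis vectors, the tangential
  \<open>(e, 0)\<close> and the normal \<open>(0, 1)\<close> at once.\<close>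

lemma partial_log_pole:
  assumes "Y \<in> closed_half_space - {P}"
  shows "partial v (log_pole P a b g) Y =
    2 * a * (v \<bullet> (Y - P)) / sqd P Y + b * snd v / sqd P Y
      - 2 * b * snd Y * (v \<bullet> (Y - P)) / (sqd P Y)\<^sup>2"
  by (rule partial_offpole[OF assms refl])
    (use sqd_pos[of Y P] assms in
      \<open>auto simp: log_pole_def intro!: derivative_eq_intros simp: field_simps power2_eq_square\<close>)

lemma partial2_log_pole:
  assumes "Y \<in> closed_half_space - {P}"
  shows "partial v (partial v (log_pole P a b g)) Y =
    2 * a * (v \<bullet> v) / sqd P Y - 4 * a * (v \<bullet> (Y - P))\<^sup>2 / (sqd P Y)\<^sup>2
      - 4 * b * (snd v * (v \<bullet> (Y - P))) / (sqd P Y)\<^sup>2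
      - 2 * b * snd Y * (v \<bullet> v) / (sqd P Y)\<^sup>2
      + 8 * b * snd Y * (v \<bullet> (Y - P))\<^sup>2 / (sqd P Y) ^ 3"
  by (rule partial_offpole[OF assms partial_log_pole])
    (use sqd_pos[of Y P] assms in
      \<open>auto intro!: derivative_eq_intros simp: field_simps power2_eq_square power3_eq_cube\<close>)

text \<open>In dimension 4 the function \<open>1/\<rho>\<close> is harmonic, so the terms with
  factor \<open>snd Y\<close> cancel and \<open>b\<close> survives only in the mixed term.\<close>

lemma laplacian_log_pole:
  assumes "Y \<in> closed_half_space - {P}"
  shows "laplacian (log_pole P a b g) Y = 4 * a / sqd P Y - 4 * b * snd (Y - P) / (sqd P Y)\<^sup>2"
proof -
  have "laplacian (log_pole P a b g) Y =
    2 * a * (\<Sum>v\<in>(Basis::pt set). v \<bullet> v) / sqd P Y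
      - 4 * a * (\<Sum>v\<in>Basis. (v \<bullet> (Y - P))\<^sup>2) / (sqd P Y)\<^sup>2
      - 4 * b * (\<Sum>v\<in>Basis. snd v * (v \<bullet> (Y - P))) / (sqd P Y)\<^sup>2
      - 2 * b * snd Y * (\<Sum>v\<in>(Basis::pt set). v \<bullet> v) / (sqd P Y)\<^sup>2
      + 8 * b * snd Y * (\<Sum>v\<in>Basis. (v \<bullet> (Y - P))\<^sup>2) / (sqd P Y) ^ 3"
    unfolding laplacian_def partial2_log_pole[OF assms]
    by (simp only: sum.distrib sum_subtractf sum_distrib_left sum_divide_distrib)
  also have "\<dots> = 4 * a / sqd P Y - 4 * b * snd (Y - P) / (sqd P Y)\<^sup>2"
    unfolding sum_Basis_inner_square sum_Basis_snd_inner sqd_def[symmetric]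
    using sqd_pos[of Y P] assms by (simp add: field_simps power2_eq_square power3_eq_cube)
  finally show ?thesis .
qed

lemma partial_laplacian_log_pole:
  assumes "Y \<in> closed_half_space - {P}"
  shows "partial v (laplacian (log_pole P a b g)) Y =
    - 8 * a * (v \<bullet> (Y - P)) / (sqd P Y)\<^sup>2 - 4 * b * snd v / (sqd P Y)\<^sup>2
      + 16 * b * snd (Y - P) * (v \<bullet> (Y - P)) / (sqd P Y) ^ 3"
  by (rule partial_offpole[OF assms laplacian_log_pole])
    (use sqd_pos[of Y P] assms in
      \<open>auto intro!: derivative_eq_intros simp: field_simps power2_eq_square power3_eq_cube\<close>)

lemma partial2_laplacian_log_pole:
  assumes "Y \<in> closed_half_space - {P}"
  shows "partial v (partial v (laplacian (log_pole P a b g))) Y =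
    - 8 * a * (v \<bullet> v) / (sqd P Y)\<^sup>2 + 32 * a * (v \<bullet> (Y - P))\<^sup>2 / (sqd P Y) ^ 3
      + 32 * b * (snd v * (v \<bullet> (Y - P))) / (sqd P Y) ^ 3
      + 16 * b * snd (Y - P) * (v \<bullet> v) / (sqd P Y) ^ 3
      - 96 * b * snd (Y - P) * (v \<bullet> (Y - P))\<^sup>2 / (sqd P Y) ^ 4"
  by (rule partial_offpole[OF assms partial_laplacian_log_pole])
    (use sqd_pos[of Y P] assms in
      \<open>auto intro!: derivative_eq_intros simp: field_simps power2_eq_square power3_eq_cube power4_eq_xxxx\<close>)

text \<open>Both \<open>1/\<rho>\<close> and \<open>\<tau>/\<rho>^2\<close>, a multiple of its
  normal derivative, are harmonic. The coefficients cancel as \<open>-32 + 32\<close> for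
  \<open>a\<close> and \<open>32 + 64 - 96\<close> for \<open>b\<close>.\<close>

lemma bilaplacian_log_pole:
  assumes "Y \<in> closed_half_space - {P}"
  shows "laplacian (laplacian (log_pole P a b g)) Y = 0"
proof -
  have "laplacian (laplacian (log_pole P a b g)) Y =
    - 8 * a * (\<Sum>v\<in>(Basis::pt set). v \<bullet> v) / (sqd P Y)\<^sup>2
      + 32 * a * (\<Sum>v\<in>Basis. (v \<bullet> (Y - P))\<^sup>2) / (sqd P Y) ^ 3
      + 32 * b * (\<Sum>v\<in>Basis. snd v * (v \<bullet> (Y - P))) / (sqd P Y) ^ 3
      + 16 * b * snd (Y - P) * (\<Sum>v\<in>(Basis::pt set). v \<bullet> v) / (sqd P Y) ^ 3
      - 96 * b * snd (Y - P) * (\<Sum>v\<in>Basis. (v \<bullet> (Y - P))\<^sup>2) / (sqd P Y) ^ 4"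
    unfolding laplacian_def[of "laplacian _"] partial2_laplacian_log_pole[OF assms]
    by (simp only: sum.distrib sum_subtractf sum_distrib_left sum_divide_distrib)
  also have "\<dots> = 0"
    unfolding sum_Basis_inner_square sum_Basis_snd_inner sqd_def[symmetric]
    using sqd_pos[of Y P] assms
    by (simp add: field_simps power2_eq_square power3_eq_cube power4_eq_xxxx)
  finally show ?thesis .
qed

section \<open>Boundary operators on \<open>log_pole\<close>\<close>

lemma tangential_laplacian_log_pole:
  assumes "Y \<in> half_space_boundary - {P}"
  shows "tangential_laplacian (log_pole P a b g) Y =
    2 * a / sqd P Y + 4 * a * (snd (Y - P))\<^sup>2 / (sqd P Y)\<^sup>2"
proof -
  have Y: "Y \<in> closed_half_space - {P}" and s: "snd Y = 0"
    using assms by (auto simp: half_space_boundary_def closed_half_space_def)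
  have q: "sqd P Y = fst (Y - P) \<bullet> fst (Y - P) + (snd (Y - P))\<^sup>2"
    by (simp add: sqd_def inner_prod_def power2_eq_square)
  have "tangential_laplacian (log_pole P a b g) Y =
    2 * a * (\<Sum>e\<in>(Basis::(real^3) set). e \<bullet> e) / sqd P Y
      - 4 * a * (\<Sum>e\<in>Basis. (e \<bullet> fst (Y - P))\<^sup>2) / (sqd P Y)\<^sup>2"
    unfolding tangential_laplacian_def partial2_log_pole[OF Y]
    by (simp add: s inner_prod_def sum_subtractf sum_distrib_left sum_divide_distrib)
  \<comment> \<open>There are three tangential directions, and the tangential part of
    \<open>Y - P\<close> has square \<open>\<rho> - \<tau>^2\<close>.\<close>
  also have "\<dots> = 6 * a / sqd P Y - 4 * a * (sqd P Y - (snd (Y - P))\<^sup>2) / (sqd P Y)\<^sup>2"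
    unfolding sum_Basis_inner_square by (simp add: q)
  also have "\<dots> = 2 * a / sqd P Y + 4 * a * (snd (Y - P))\<^sup>2 / (sqd P Y)\<^sup>2"
    using sqd_pos[of Y P] assms by (simp add: field_simps power2_eq_square)
  finally show ?thesis .
qed

lemma dt_log_pole:
  assumes "Y \<in> closed_half_space - {P}"
  shows "dt (log_pole P a b g) Y =
    (2 * a * snd (Y - P) + b) / sqd P Y - 2 * b * snd Y * snd (Y - P) / (sqd P Y)\<^sup>2"
  unfolding dt_def partial_log_pole[OF assms] by (simp add: inner_prod_def add_divide_distrib)

text \<open>For tangential \<open>v\<close> only \<open>\<rho>\<close> varies. The term with
  \<open>snd Y\<close> stays because \<open>partial_offpole\<close> asks for the formula on the
  whole closed half-space off the pole; it vanishes after the second derivative is evaluated on the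
  boundary.\<close>

lemma partial_dt_log_pole:
  assumes "Y \<in> closed_half_space - {P}" "snd v = 0"
  shows "partial v (dt (log_pole P a b g)) Y =
    - 2 * (2 * a * snd (Y - P) + b) * (v \<bullet> (Y - P)) / (sqd P Y)\<^sup>2
      + 8 * b * snd Y * snd (Y - P) * (v \<bullet> (Y - P)) / (sqd P Y) ^ 3"
  by (rule partial_offpole[OF assms(1) dt_log_pole])
    (use sqd_pos[of Y P] assms in
      \<open>auto intro!: derivative_eq_intros simp: field_simps power2_eq_square power3_eq_cube\<close>)

lemma partial2_dt_log_pole:
  assumes "Y \<in> half_space_boundary - {P}" and v: "snd v = 0"
  shows "partial v (partial v (dt (log_pole P a b g))) Y =
    (2 * a * snd (Y - P) + b) *
      (8 * (v \<bullet> (Y - P))\<^sup>2 / (sqd P Y) ^ 3 - 2 * (v \<bullet> v) / (sqd P Y)\<^sup>2)"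
  by (rule partial_offpole[OF _ partial_dt_log_pole[OF _ v]])
    (use sqd_pos[of Y P] assms in
      \<open>auto intro!: derivative_eq_intros
         simp: half_space_boundary_def closed_half_space_def
           field_simps power2_eq_square power3_eq_cube\<close>)

lemma tangential_laplacian_dt_log_pole:
  assumes "Y \<in> half_space_boundary - {P}"
  shows "tangential_laplacian (dt (log_pole P a b g)) Y =
    (2 * a * snd (Y - P) + b) * (2 / (sqd P Y)\<^sup>2 - 8 * (snd (Y - P))\<^sup>2 / (sqd P Y) ^ 3)"
proof -
  have q: "sqd P Y = fst (Y - P) \<bullet> fst (Y - P) + (snd (Y - P))\<^sup>2"
    by (simp add: sqd_def inner_prod_def power2_eq_square)
  have "tangential_laplacian (dt (log_pole P a b g)) Y = (2 * a * snd (Y - P) + b) *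
      (8 * (\<Sum>e\<in>Basis. (e \<bullet> fst (Y - P))\<^sup>2) / (sqd P Y) ^ 3
        - 2 * (\<Sum>e\<in>(Basis::(real^3) set). e \<bullet> e) / (sqd P Y)\<^sup>2)"
    by (simp add: tangential_laplacian_def partial2_dt_log_pole[OF assms] inner_prod_def[of "(_, _)"]
      del: snd_diff fst_diff flip: sum_distrib_left)
      (simp add: sum_subtractf sum_distrib_left sum_divide_distrib del: snd_diff fst_diff)
  also have "\<dots> = (2 * a * snd (Y - P) + b) *
      (8 * (sqd P Y - (snd (Y - P))\<^sup>2) / (sqd P Y) ^ 3 - 6 / (sqd P Y)\<^sup>2)"
    unfolding sum_Basis_inner_square by (simp add: q)
  also have "8 * (sqd P Y - (snd (Y - P))\<^sup>2) / (sqd P Y) ^ 3 - 6 / (sqd P Y)\<^sup>2 =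
      2 / (sqd P Y)\<^sup>2 - 8 * (snd (Y - P))\<^sup>2 / (sqd P Y) ^ 3"
    using sqd_pos[of Y P] assms by (simp add: field_simps power2_eq_square power3_eq_cube)
  finally show ?thesis .
qed

lemma boundary_op_log_pole:
  assumes "Y \<in> half_space_boundary - {P}"
    and "k \<le> 3"
  shows "boundary_op k (log_pole P a b g) Y = boundary_value k a b g (snd (Y - P)) (sqd P Y)"
proof -
  have Y: "Y \<in> closed_half_space - {P}" and s: "snd Y = 0"
    using assms by (auto simp: half_space_boundary_def closed_half_space_def)
  have q: "sqd P Y > 0"
    using assms by (intro sqd_pos) auto
  have b0: "boundary_op 0 (log_pole P a b g) Y = a * ln (sqd P Y) + g"
    by (simp add: boundary_op_def log_pole_def s)
  have b1: "boundary_op 1 (log_pole P a b g) Y = - (2 * a * snd (Y - P) + b) / sqd P Y"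
    by (simp add: boundary_op_def dt_log_pole[OF Y] s minus_divide_left)
  have "dt (dt (log_pole P a b g)) Y =
      2 * a / sqd P Y - 4 * a * (snd (Y - P))\<^sup>2 / (sqd P Y)\<^sup>2 - 4 * b * snd (Y - P) / (sqd P Y)\<^sup>2"
    unfolding dt_def partial2_log_pole[OF Y] by (simp add: s inner_prod_def)
  then have b2: "boundary_op 2 (log_pole P a b g) Y =
      - (8 * a * (snd (Y - P))\<^sup>2 + 4 * b * snd (Y - P)) / (sqd P Y)\<^sup>2"
    using q by (simp add: boundary_op_def tangential_laplacian_log_pole[OF assms(1)] field_simps)
  have "dt (laplacian (log_pole P a b g)) Y = - 8 * a * snd (Y - P) / (sqd P Y)\<^sup>2
      - 4 * b / (sqd P Y)\<^sup>2 + 16 * b * (snd (Y - P))\<^sup>2 / (sqd P Y) ^ 3"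
    unfolding dt_def partial_laplacian_log_pole[OF Y]
    by (simp add: inner_prod_def power2_eq_square)
  \<comment> \<open>All terms in \<open>b\<close> cancel, which is why the third boundary value
    depends on \<open>a\<close> alone.\<close>
  moreover have "- 8 * a * \<tau> / r\<^sup>2 - 4 * b / r\<^sup>2 + 16 * b * \<tau>\<^sup>2 / r ^ 3
      + 2 * ((2 * a * \<tau> + b) * (2 / r\<^sup>2 - 8 * \<tau>\<^sup>2 / r ^ 3)) = - 32 * a * \<tau> ^ 3 / r ^ 3" for \<tau> r :: real
    by (simp add: algebra_simps add_divide_distrib power2_eq_square power3_eq_cube)
  ultimately have b3: "boundary_op 3 (log_pole P a b g) Y = - 32 * a * (snd (Y - P)) ^ 3 / (sqd P Y) ^ 3"
    by (simp add: boundary_op_def tangential_laplacian_dt_log_pole[OF assms(1)] del: snd_diff)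
  from \<open>k \<le> 3\<close> consider "k = 0" | "k = 1" | "k = 2" | "k = 3"
    by linarith
  then show ?thesis
    by cases (use b0 b1 b2 b3 in \<open>simp_all add: boundary_value_def\<close>)
qed

end

section \<open>The four Green functions\<close>

text \<open>The logarithm of the squared distance doubles that of the norm, so the factor 1/4
  becomes 1/8.\<close>

lemma fund_sol_eq_log_pole:
  "fund_sol (X - Y) = log_pole X (- (1 / (8 * sphere3_area))) 0 0 Y"
proof (cases "X = Y")
  \<comment> \<open>Both sides vanish at the pole by the default \<open>ln 0 = 0\<close>; the
    equation can thus rewrite under a binder.\<close>
  case True
  then show ?thesis
    by (simp add: fund_sol_def log_pole_def sqd_def)
next
  case False
  then show ?thesis
    by (simp add: fund_sol_def log_pole_def sqd_eq_norm ln_realpow)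
qed

lemma norm_quotient_reflect:
  assumes "Y \<noteq> reflect X"
  shows "(norm (X - Y))\<^sup>2 / (norm (reflect X - Y))\<^sup>2 - 1 = - 4 * snd X * snd Y / sqd (reflect X) Y"
proof -
  have "sqd X Y = sqd (reflect X) Y - 4 * snd X * snd Y"
    by (simp add: sqd_def reflect_def inner_prod_def algebra_simps)
  then show ?thesis
    using sqd_pos[OF assms] by (simp add: sqd_eq_norm[symmetric] diff_divide_distrib)
qed

text \<open>Regularity and biharmonicity hold for all \<open>a\<close>, \<open>b\<close>,
  \<open>g\<close>, because the pole \<open>reflect X\<close> lies outside the closed half-space.
  What remains is a scalar identity per boundary operator.\<close>

lemma biharmonic_greenI:
  fixes G :: "pt \<Rightarrow> pt \<Rightarrow> real" and a b g :: real
  defines "H \<equiv> \<lambda>X. log_pole (reflect X) a (b * snd X) g"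
  assumes ij: "i < j" "j \<le> 3" "i + j \<noteq> 3"
    and G: "\<And>X Y. Y \<noteq> reflect X \<Longrightarrow> G X Y = fund_sol (X - Y) + H X Y"
    and bd: "\<And>k \<tau> q. k \<in> {i, j} \<Longrightarrow> q > 0 \<Longrightarrow> boundary_value k a (b * \<tau>) g \<tau> q =
      - boundary_value k (- (1 / (8 * sphere3_area))) 0 0 (- \<tau>) q"
  shows "biharmonic_green i j G"
  unfolding biharmonic_green_def
proof (intro conjI exI[of _ H] ballI impI ij)
  fix X Y :: pt
  assume "X \<in> closed_half_space" "Y \<in> closed_half_space" "X \<noteq> Y"
  \<comment> \<open>If \<open>Y = reflect X\<close>, both last coordinates are zero and
    \<open>Y = X\<close>.\<close>
  then have "Y \<noteq> reflect X"
    by (auto simp: closed_half_space_def reflect_def prod_eq_iff)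
  then show "G X Y = fund_sol (X - Y) + H X Y"
    by (rule G)
next
  fix X :: pt assume X: "X \<in> half_space"
  then have P: "reflect X \<notin> closed_half_space"
    by (simp add: half_space_def closed_half_space_def reflect_def)
  show "C_upto 4 (H X)"
    unfolding H_def by (rule C_upto_log_pole[OF P])
  show "laplacian (laplacian (H X)) Y = 0" if "Y \<in> half_space" for Y
    unfolding H_def
    by (rule bilaplacian_log_pole)
      (use that P in \<open>auto simp: half_space_def closed_half_space_def\<close>)
  fix k Y assume k: "k \<in> {i, j}" and Y: "Y \<in> half_space_boundary"
  have "k \<le> 3"
    using k ij by auto
  have off: "Y \<in> half_space_boundary - {X}" "Y \<in> half_space_boundary - {reflect X}"
    using X Y by (auto simp: half_space_boundary_def half_space_def reflect_def)
  \<comment> \<open>For \<open>Y\<close> on the boundary, \<open>sqd (reflect X) Y = sqd X Y\<close>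
    and \<open>snd (Y - reflect X) = snd X\<close>.\<close>
  have "boundary_op k (H X) Y = boundary_value k a (b * snd X) g (snd X) (sqd X Y)"
    using Y by (simp add: H_def boundary_op_log_pole[OF off(2) \<open>k \<le> 3\<close>])
      (simp add: half_space_boundary_def sqd_def inner_prod_def reflect_def)
  also have "\<dots> = - boundary_value k (- (1 / (8 * sphere3_area))) 0 0 (- snd X) (sqd X Y)"
    by (rule bd[OF k sqd_pos]) (use off in auto)
  also have "\<dots> = - boundary_op k (\<lambda>Y. fund_sol (X - Y)) Y"
    using Y by (simp add: fund_sol_eq_log_pole boundary_op_log_pole[OF off(1) \<open>k \<le> 3\<close>]
      half_space_boundary_def)
  finally show "boundary_op k (H X) Y = - boundary_op k (\<lambda>Y. fund_sol (X - Y)) Y" .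
qed

theorem theorem1p3:
  fixes C :: real
  shows
    "biharmonic_green 0 1 (\<lambda>X Y. fund_sol (X - Y) - fund_sol (reflect X - Y)
        + 1 / (8 * sphere3_area) * ((norm (X - Y))\<^sup>2 / (norm (reflect X - Y))\<^sup>2 - 1))
     \<and> biharmonic_green 2 3 (\<lambda>X Y. fund_sol (X - Y) + fund_sol (reflect X - Y)
        - 1 / (8 * sphere3_area) * ((norm (X - Y))\<^sup>2 / (norm (reflect X - Y))\<^sup>2 - 1) + C)
     \<and> biharmonic_green 0 2 (\<lambda>X Y. fund_sol (X - Y) - fund_sol (reflect X - Y))
     \<and> biharmonic_green 1 3 (\<lambda>X Y. fund_sol (X - Y) + fund_sol (reflect X - Y) + C)"
proof -
  define c where "c = 1 / (8 * sphere3_area)"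
  have fund: "fund_sol (reflect X - Y) = - c * ln (sqd (reflect X) Y)" for X Y
    by (simp add: fund_sol_eq_log_pole log_pole_def c_def)
  note green = biharmonic_greenI[folded c_def]
  show ?thesis
    unfolding c_def[symmetric]
  \<comment> \<open>The boundary identities for indices 0, 1, 2, 3 become, in order:
    \<open>a = c\<close> and \<open>g = 0\<close>; \<open>2a + b = -2c\<close>;
    \<open>2a + b = 2c\<close>; \<open>a = -c\<close>. Each pair of indices fixes \<open>a\<close>
    and \<open>b\<close>, while \<open>g\<close> is free unless index 0 occurs.\<close>
  proof (intro conjI)
    show "biharmonic_green 0 1 (\<lambda>X Y. fund_sol (X - Y) - fund_sol (reflect X - Y)
        + c * ((norm (X - Y))\<^sup>2 / (norm (reflect X - Y))\<^sup>2 - 1))"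
      by (rule green[where a = c and b = "- 4 * c" and g = 0])
        (simp_all add: fund norm_quotient_reflect log_pole_def, auto simp: boundary_value_def field_simps)
    show "biharmonic_green 2 3 (\<lambda>X Y. fund_sol (X - Y) + fund_sol (reflect X - Y)
        - c * ((norm (X - Y))\<^sup>2 / (norm (reflect X - Y))\<^sup>2 - 1) + C)"
      by (rule green[where a = "- c" and b = "4 * c" and g = C])
        (simp_all add: fund norm_quotient_reflect log_pole_def,
          auto simp: boundary_value_def power2_eq_square algebra_simps)
    show "biharmonic_green 0 2 (\<lambda>X Y. fund_sol (X - Y) - fund_sol (reflect X - Y))"
      by (rule green[where a = c and b = 0 and g = 0])
        (auto simp: fund log_pole_def boundary_value_def)
    show "biharmonic_green 1 3 (\<lambda>X Y. fund_sol (X - Y) + fund_sol (reflect X - Y) + C)"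
      by (rule green[where a = "- c" and b = 0 and g = C])
        (auto simp: fund log_pole_def boundary_value_def)
  qed
qed

end
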